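(* Let $\mathcal{X}$ be a set, $d\ge0$ an integer, and let $\mathcal{F}_d=\{\mathcal{C}_{f,d} : f:\mathcal{X}\to\{0,1\}\}$ be the family of $d$-Hamming balls. Consider transductive online learning of $\mathcal{F}_d$ in the realizable setting over $T$ rounds. Then optimal mistake bounds can be achieved using at most $2^{d+1}$ queries to the ERM oracle: there is an algorithm making at most $2^{d+1}$ ERM queries such that for every $\mathcal{C}\in\mathcal{F}_d$ and every instance sequence $x_{1:T}$, its worst-case (over $c\in\mathcal{C}$) expected number of mistakes equals the optimal value $M^*(\mathcal{C},x_{1:T})$ achievable when $\mathcal{C}$ is known to the learner.
   Context: $d$-Hamming ball around $f:\mathcal{X}\to\{0,1\}$: $\mathcal{C}_{f,d}=\{g:\mathcal{X}\to\{0,1\} : |\{x\in\mathcal{X}: g(x)\neq f(x)\}|\le d\}$. Transductive online learning with oracle access (realizable setting). The family and horizon $T$ are known to the learner. An oblivious adversary fixes an unknown class $\mathcal{C}$ in the family, a target $c\in\mathcal{C}$ and a sequence $x_{1:T}\in\mathcal{X}^T$. The whole sequence is revealed to the learner at the start. The learner can access $\mathcal{C}$ only through an oracle, which it may query at any time. In round $t=1,\dots,T$ the learner picks a distribution on $\{0,1\}$ and predicts $\hat y_t$ drawn from it, then $y_t=c(x_t)$ is revealed; a mistake occurs if $\hat y_t\neq y_t$. $M^*(\mathcal{C},x_{1:T})$ is the infimum, over all (possibly randomized) learners that know $\mathcal{C}$ and $x_{1:T}$ in advance, of $\sup_{c\in\mathcal{C}}$ of the expected number of mistakes. ERM oracle: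 given any finite $S\subset\mathcal{X}\times\{0,1\}$, it returns some $c\in\mathcal{C}$ consistent with $S$ if one exists, and "not realizable" otherwise; the algorithm's guarantee must hold for every valid choice of answers. *)

theory Defs
  imports "HOL-Probability.Probability" "HOL-Library.FSet"
begin

text \<open>The instance space is the type \<open>'a\<close> and the label set \<open>{0,1}\<close> is \<^typ>\<open>bool\<close>.\<close>

text \<open>The finiteness conjunct is needed because \<^const>\<open>card\<close> of an infinite set is 0.\<close>

definition hamming_ball :: "('a \<Rightarrow> bool) \<Rightarrow> nat \<Rightarrow> ('a \<Rightarrow> bool) set" where
  "hamming_ball f d = {g. finite {x. g x \<noteq> f x} \<and> card {x. g x \<noteq> f x} \<le> d}"

definition hamming_family :: "nat \<Rightarrow> ('a \<Rightarrow> bool) set set" where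
  "hamming_family d = {hamming_ball f d | f. True}"


type_synonym 'a sample = "('a \<times> bool) fset"

text \<open>\<open>None\<close> is the answer ``not realizable''.\<close>

type_synonym 'a answer = "('a \<Rightarrow> bool) option"

text \<open>A history lists, in chronological order, the oracle queries with their answers and the
  completed rounds; \<open>Round b y\<close> is a round with prediction \<open>b\<close> and true label \<open>y\<close>.\<close>

datatype 'a event = Query "'a sample" "'a answer" | Round bool bool

type_synonym 'a history = "'a event list"

text \<open>What a learner does before a prediction: a well-founded tree of adaptively chosen oracle
  queries (hence finitely many on every branch), ending in a distribution for the prediction.\<close>

datatype 'a computation =
    Predict "bool pmf"
  | Ask "'a sample" "'a answer \<Rightarrow> 'a computation"

text \<open>The first argument is the whole instance sequence, revealed before the first round. A learner
  has no access to the class except through the answers recorded in the history.\<close>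

type_synonym 'a learner = "'a list \<Rightarrow> 'a history \<Rightarrow> 'a computation"

text \<open>An oracle may choose its answers depending on everything that has happened so far, so the
  same sample may receive different answers at different times.\<close>

type_synonym 'a oracle_policy = "'a history \<Rightarrow> 'a sample \<Rightarrow> 'a answer"

definition consistent :: "('a \<Rightarrow> bool) \<Rightarrow> 'a sample \<Rightarrow> bool" where
  "consistent c S \<longleftrightarrow> (\<forall>(x, y) \<in> fset S. c x = y)"

definition valid_erm :: "('a \<Rightarrow> bool) set \<Rightarrow> 'a oracle_policy \<Rightarrow> bool" where
  "valid_erm C orc \<longleftrightarrow>
     (\<forall>h S. case orc h S of
        Some c \<Rightarrow> c \<in> C \<and> consistent c S
      | None \<Rightarrow> \<not> (\<exists>c\<in>C. consistent c S))"

primrec exec :: "'a oracle_policy \<Rightarrow> 'a computation \<Rightarrow> 'a history \<Rightarrow> bool pmf \<times> 'a history" where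
  "exec orc (Predict p) h = (p, h)"
| "exec orc (Ask S k) h = exec orc (k (orc h S)) (h @ [Query S (orc h S)])"

text \<open>The distribution of the final history when, starting from history \<open>h\<close>, the remaining true
  labels are those in the list. The learner \<open>L\<close> is already applied to the instances.\<close>

primrec play ::
  "'a oracle_policy \<Rightarrow> ('a history \<Rightarrow> 'a computation) \<Rightarrow> 'a history \<Rightarrow> bool list \<Rightarrow> 'a history pmf"
where
  "play orc L h [] = return_pmf h"
| "play orc L h (y # ys) =
     (let (p, h') = exec orc (L h) h
      in bind_pmf p (\<lambda>b. play orc L (h' @ [Round b y]) ys))"

definition run :: "'a learner \<Rightarrow> 'a oracle_policy \<Rightarrow> 'a list \<Rightarrow> ('a \<Rightarrow> bool) \<Rightarrow> 'a history pmf" where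
  "run A orc xs c = play orc (A xs) [] (map c xs)"

definition num_queries :: "'a history \<Rightarrow> nat" where
  "num_queries h = length (filter (\<lambda>e. \<exists>S a. e = Query S a) h)"

definition num_mistakes :: "'a history \<Rightarrow> nat" where
  "num_mistakes h = length (filter (\<lambda>e. \<exists>b y. e = Round b y \<and> b \<noteq> y) h)"

definition expected_mistakes ::
  "'a learner \<Rightarrow> 'a oracle_policy \<Rightarrow> 'a list \<Rightarrow> ('a \<Rightarrow> bool) \<Rightarrow> real" where
  "expected_mistakes A orc xs c =
     measure_pmf.expectation (run A orc xs c) (\<lambda>h. real (num_mistakes h))"


text \<open>A learner that knows the class and the instances in advance needs no oracle: it is any map
  from the past rounds, given as (prediction, label) pairs, to a distribution for the next
  prediction. Dependence on its own past predictions makes this as general as arbitrary private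
  randomness shared between rounds.\<close>

type_synonym informed_learner = "(bool \<times> bool) list \<Rightarrow> bool pmf"

primrec informed_play ::
  "informed_learner \<Rightarrow> (bool \<times> bool) list \<Rightarrow> bool list \<Rightarrow> (bool \<times> bool) list pmf" where
  "informed_play L r [] = return_pmf r"
| "informed_play L r (y # ys) = bind_pmf (L r) (\<lambda>b. informed_play L (r @ [(b, y)]) ys)"

definition informed_expected_mistakes ::
  "informed_learner \<Rightarrow> 'a list \<Rightarrow> ('a \<Rightarrow> bool) \<Rightarrow> real" where
  "informed_expected_mistakes L xs c =
     measure_pmf.expectation (informed_play L [] (map c xs))
       (\<lambda>r. real (length (filter (\<lambda>(b, y). b \<noteq> y) r)))"

text \<open>This is \<open>M\<^sup>*(C, x\<^sub>1, \<dots>, x\<^sub>T)\<close>. All expectations lie between 0 and \<open>T\<close>, so for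
  nonempty \<open>C\<close> the real-valued infimum and supremum are the intended ones.\<close>

definition optimal_mistakes :: "('a \<Rightarrow> bool) set \<Rightarrow> 'a list \<Rightarrow> real" where
  "optimal_mistakes C xs =
     (INF L :: informed_learner. SUP c\<in>C. informed_expected_mistakes L xs c)"

end

theory Submission
  imports Defs
begin

text \<open>Query all \<open>2 ^ (d + 1)\<close> labellings of some \<open>d + 1\<close> points of the sequence. The answers determine the
  centre \<open>f\<close>: the only unrealizable labelling is \<open>\<not> f\<close>, and a labelling that disagrees with \<open>f\<close> on
  all but one of the points exhausts the radius, so every answer to it equals \<open>f\<close> elsewhere. If the
  sequence has at most \<open>d\<close> distinct points, all balls induce the same labellings of it. The learner
  can therefore simulate an optimal informed learner, which exists because the sequential game on a
  finite set of label sequences has a saddle point.\<close>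

section \<open>The game with known class\<close>

lemma pmf_bool_sum: "pmf p True + pmf p False = 1"
proof -
  have "(\<Sum>b\<in>UNIV. pmf p b) = 1"
    by (rule sum_pmf_eq_1) auto
  then show ?thesis
    by (simp add: UNIV_bool)
qed

lemma expectation_bind_bool:
  fixes h :: "'a \<Rightarrow> real"
  assumes "\<And>b. finite (set_pmf (f b))"
  shows "measure_pmf.expectation (bind_pmf p f) h =
    pmf p True * measure_pmf.expectation (f True) h + pmf p False * measure_pmf.expectation (f False) h"
  using assms by (subst pmf_expectation_bind[of UNIV]) (auto simp: UNIV_bool)

text \<open>Unrolled from the first round: the learner is replaced by its continuation, so
  inductions can range over all learners and carry no past.\<close>

primrec expected_errors :: "informed_learner \<Rightarrow> bool list \<Rightarrow> real" where
  "expected_errors L [] = 0"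
| "expected_errors L (y # ys) =
     pmf (L []) (\<not> y) + (\<Sum>b\<in>UNIV. pmf (L []) b * expected_errors (\<lambda>r. L ((b, y) # r)) ys)"

lemma finite_set_pmf_informed_play: "finite (set_pmf (informed_play L r ys))"
  by (induction ys arbitrary: r) auto

lemma expectation_informed_play:
  fixes e :: "(bool \<times> bool) list \<Rightarrow> real"
  assumes e: "\<And>r b y. e (r @ [(b, y)]) = e r + of_bool (b \<noteq> y)"
  shows "measure_pmf.expectation (informed_play L r ys) e = e r + expected_errors (\<lambda>r'. L (r @ r')) ys"
proof (induction ys arbitrary: r)
  case (Cons y ys)
  have *: "pmf (L r) True = 1 - pmf (L r) False"
    using pmf_bool_sum[of "L r"] by simp
  show ?case
    by (cases y)
      (simp_all add: expectation_bind_bool finite_set_pmf_informed_play Cons e UNIV_bool * algebra_simps)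
qed simp

lemma informed_expected_mistakes_eq:
  "informed_expected_mistakes L xs c = expected_errors L (map c xs)"
  unfolding informed_expected_mistakes_def by (subst expectation_informed_play) auto

lemma expected_errors_le_length: "expected_errors L ys \<le> length ys"
proof (induction ys arbitrary: L)
  case (Cons y ys)
  have "(\<Sum>b\<in>UNIV. pmf (L []) b * expected_errors (\<lambda>r. L ((b, y) # r)) ys)
      \<le> (\<Sum>b\<in>UNIV. pmf (L []) b * length ys)"
    by (intro sum_mono mult_left_mono Cons) simp
  also have "\<dots> = length ys"
    using sum_pmf_eq_1[of UNIV "L []"] by (simp flip: sum_distrib_right)
  finally show ?case
    using pmf_le_1[of "L []" "\<not> y"] by simp
qed simp

text \<open>After either first prediction the continuation is again a learner, and
  \<open>\<mu>\<close> does not depend on the prediction, so \<open>v\<close> bounds both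
  branches.\<close>

lemma expectation_Cons_ge:
  assumes "finite (set_pmf \<mu>)"
    and v: "\<And>L. v \<le> measure_pmf.expectation \<mu> (expected_errors L)"
  shows "pmf (L []) (\<not> e) + v \<le> measure_pmf.expectation \<mu> (\<lambda>ys. expected_errors L (e # ys))"
proof -
  have "v = (\<Sum>b\<in>UNIV. pmf (L []) b * v)"
    using sum_pmf_eq_1[of UNIV "L []"] by (simp flip: sum_distrib_right)
  also have "\<dots> \<le> (\<Sum>b\<in>UNIV. pmf (L []) b *
      measure_pmf.expectation \<mu> (expected_errors (\<lambda>r. L ((b, e) # r))))"
    by (intro sum_mono mult_left_mono v) simp
  finally show ?thesis
    using assms(1) by (simp add: integrable_measure_pmf_finite)
qed

text \<open>\<open>\<mu>\<close> is a least favourable prior. A bound on the Bayes risk, unlike a bound on the worst case, is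
  preserved under averaging over the learner's own past predictions.\<close>

lemma saddle_point:
  assumes "Y \<noteq> {}" "\<And>ys. ys \<in> Y \<Longrightarrow> length ys = m"
  shows "\<exists>L v \<mu>. set_pmf \<mu> \<subseteq> Y \<and> finite (set_pmf \<mu>) \<and> (\<forall>ys\<in>Y. expected_errors L ys \<le> v) \<and>
    (\<forall>L'. v \<le> measure_pmf.expectation \<mu> (expected_errors L'))"
  using assms
proof (induction m arbitrary: Y)
  case 0
  then have "Y = {[]}"
    by auto
  then show ?case
    by (intro exI[of _ undefined] exI[of _ 0] exI[of _ "return_pmf []"]) simp
next
  case (Suc m)
  define Z where "Z e = {ys. e # ys \<in> Y}" for e
  have Y: "ys \<in> Y \<Longrightarrow> \<exists>e zs. ys = e # zs \<and> zs \<in> Z e" for ys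
    using Suc.prems(2)[of ys] by (cases ys) (auto simp: Z_def)
  have "\<forall>e. \<exists>L v \<mu>. Z e \<noteq> {} \<longrightarrow> set_pmf \<mu> \<subseteq> Z e \<and> finite (set_pmf \<mu>) \<and>
      (\<forall>ys\<in>Z e. expected_errors L ys \<le> v) \<and>
      (\<forall>L'. v \<le> measure_pmf.expectation \<mu> (expected_errors L'))"
    using Suc.IH[of "Z _"] Suc.prems(2) by (fastforce simp: Z_def)
  then obtain L v \<mu> where \<mu>: "\<And>e. Z e \<noteq> {} \<Longrightarrow> set_pmf (\<mu> e) \<subseteq> Z e"
    and fin: "\<And>e. Z e \<noteq> {} \<Longrightarrow> finite (set_pmf (\<mu> e))"
    and L: "\<And>e ys. ys \<in> Z e \<Longrightarrow> expected_errors (L e) ys \<le> v e"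
    and v: "\<And>e L'. Z e \<noteq> {} \<Longrightarrow> v e \<le> measure_pmf.expectation (\<mu> e) (expected_errors L')"
    by (metis empty_iff)
  \<comment> \<open>After the first round, \<open>M p\<close> follows the learner for the revealed
    label and forgets its own prediction.\<close>
  define M where "M p r = (case r of [] \<Rightarrow> p | (b, y) # r' \<Rightarrow> L y r')" for p and r :: "(bool \<times> bool) list"
  have M: "expected_errors (M p) (e # ys) = pmf p (\<not> e) + expected_errors (L e) ys" for p e ys
    using sum_pmf_eq_1[of UNIV p] by (simp add: M_def flip: sum_distrib_right)
  have bound: "pmf (L' []) (\<not> e) + v e \<le>
      measure_pmf.expectation (\<mu> e) (\<lambda>ys. expected_errors L' (e # ys))" if "Z e \<noteq> {}" for e L'
    by (rule expectation_Cons_ge[OF fin v]) (rule that)+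
  \<comment> \<open>The question is whether one first label \<open>e\<close> dominates: even a sure
    mistake on the other label leads to a total of at most \<open>v e\<close>. The quantifier over
    \<open>Z (\<not> e)\<close> includes the case that \<open>\<not> e\<close> cannot occur, so
    otherwise both labels occur.\<close>
  show ?case
  proof (cases "\<exists>e. Z e \<noteq> {} \<and> (\<forall>ys\<in>Z (\<not> e). 1 + v (\<not> e) \<le> v e)")
    case True
    then obtain e where e: "Z e \<noteq> {}" "\<And>ys. ys \<in> Z (\<not> e) \<Longrightarrow> 1 + v (\<not> e) \<le> v e"
      by blast
    have "expected_errors (M (return_pmf e)) ys \<le> v e" if ys: "ys \<in> Y" for ys
    proof -
      obtain y zs where yzs: "ys = y # zs" "zs \<in> Z y"
        using Y[OF ys] by blast
      have "expected_errors (L y) zs \<le> v y"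
        by (rule L) fact
      then show ?thesis
        using yzs e(2)[of zs] by (cases "y = e") (auto simp: M simp del: expected_errors.simps)
    qed
    \<comment> \<open>The first label is always \<open>e\<close>; an error of the learner there only
      adds to \<open>v e\<close>.\<close>
    moreover have "v e \<le> measure_pmf.expectation (map_pmf ((#) e) (\<mu> e)) (expected_errors L')" for L'
      unfolding integral_map_pmf using bound[OF e(1), of L'] pmf_nonneg[of "L' []" "\<not> e"]
      by linarith
    moreover have "set_pmf (map_pmf ((#) e) (\<mu> e)) \<subseteq> Y"
      using \<mu>[OF e(1)] by (auto simp: Z_def)
    ultimately show ?thesis
      using fin[OF e(1)] by (intro exI[of _ "M (return_pmf e)"] exI[of _ "v e"]
          exI[of _ "map_pmf ((#) e) (\<mu> e)"]) simp
  next
    case False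
    have ne: "Z e \<noteq> {}" for e
    proof (rule ccontr)
      assume "\<not> Z e \<noteq> {}"
      then have "Z (\<not> e) = {}"
        using False by auto
      with \<open>\<not> Z e \<noteq> {}\<close> have "Z e' = {}" for e'
        by (cases "e' = e") auto
      then show False
        using Suc.prems(1) Y by blast
    qed
    have less: "v e < 1 + v (\<not> e)" for e
      using False ne[of e] by force
    \<comment> \<open>Predicting \<open>True\<close> with probability \<open>q\<close> equalises the
      two risks: \<open>(1 - q) + v True = q + v False = w\<close>.\<close>
    define q where "q = (1 + v True - v False) / 2"
    define w where "w = (1 + v True + v False) / 2"
    \<comment> \<open>A fair first label costs every learner exactly 1/2, and the rest at least the
      average of \<open>v True\<close> and \<open>v False\<close>: together
      \<open>w\<close>.\<close>
    define \<nu> where "\<nu> = bind_pmf (bernoulli_pmf (1/2)) (\<lambda>e. map_pmf ((#) e) (\<mu> e))"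
    have q: "0 \<le> q" "q \<le> 1"
      using less[of True] less[of False] by (auto simp: q_def)
    have "expected_errors (M (bernoulli_pmf q)) ys \<le> w" if ys: "ys \<in> Y" for ys
    proof -
      obtain y zs where yzs: "ys = y # zs" "zs \<in> Z y"
        using Y[OF ys] by blast
      have "expected_errors (L y) zs \<le> v y"
        by (rule L) fact
      then show ?thesis
        using yzs q by (cases y) (auto simp: M q_def w_def field_simps simp del: expected_errors.simps)
    qed
    moreover have "w \<le> measure_pmf.expectation \<nu> (expected_errors L')" for L'
      using bound[OF ne, of L' True] bound[OF ne, of L' False] pmf_bool_sum[of "L' []"]
      by (simp add: \<nu>_def w_def expectation_bind_bool fin[OF ne]
          del: expected_errors.simps)
    moreover have "set_pmf \<nu> \<subseteq> Y"
      using \<mu>[OF ne] by (fastforce simp: Z_def \<nu>_def)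
    moreover have "finite (set_pmf \<nu>)"
      using fin[OF ne] by (simp add: \<nu>_def)
    ultimately show ?thesis
      by (intro exI[of _ "M (bernoulli_pmf q)"] exI[of _ w] exI[of _ \<nu>]) simp
  qed
qed

text \<open>The Bayes risk under \<open>\<mu>\<close> never exceeds the worst case, so
  \<open>v\<close> is a lower bound for every learner, and \<open>L\<close> meets it. Exact
  optimality in the theorem requires this attainment of the infimum.\<close>

lemma optimal_learner_exists:
  assumes "C \<noteq> {}"
  shows "\<exists>L. (SUP c\<in>C. informed_expected_mistakes L xs c) = optimal_mistakes C xs"
proof -
  define Y where "Y = (\<lambda>c. map c xs) ` C"
  have "\<exists>L v \<mu>. set_pmf \<mu> \<subseteq> Y \<and> finite (set_pmf \<mu>) \<and> (\<forall>ys\<in>Y. expected_errors L ys \<le> v) \<and>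
    (\<forall>L'. v \<le> measure_pmf.expectation \<mu> (expected_errors L'))"
    by (rule saddle_point[where m = "length xs"]) (use assms in \<open>auto simp: Y_def\<close>)
  then obtain L v \<mu> where \<mu>: "set_pmf \<mu> \<subseteq> Y" "finite (set_pmf \<mu>)"
    and L: "\<And>ys. ys \<in> Y \<Longrightarrow> expected_errors L ys \<le> v"
    and v: "\<And>L'. v \<le> measure_pmf.expectation \<mu> (expected_errors L')"
    by blast
  define s where "s L' = (SUP c\<in>C. informed_expected_mistakes L' xs c)" for L'
  have "expected_errors L' ys \<le> s L'" if ys: "ys \<in> Y" for L' ys
  proof -
    obtain c where c: "c \<in> C" "ys = map c xs"
      using ys by (auto simp: Y_def)
    have "bdd_above ((\<lambda>c. expected_errors L' (map c xs)) ` C)"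
      by (rule bdd_aboveI2[of _ _ "real (length xs)"]) (rule order_trans[OF expected_errors_le_length], simp)
    then show ?thesis
      unfolding s_def informed_expected_mistakes_eq using c by (auto intro: cSUP_upper)
  qed
  then have "measure_pmf.expectation \<mu> (expected_errors L') \<le> s L'" for L'
    using \<mu> by (intro measure_pmf.integral_le_const)
      (auto simp: AE_measure_pmf_iff integrable_measure_pmf_finite)
  with v have lower: "v \<le> s L'" for L'
    using order_trans by blast
  have "s L \<le> v"
    unfolding s_def informed_expected_mistakes_eq
    by (rule cSUP_least) (use assms L in \<open>auto simp: Y_def\<close>)
  with lower have "optimal_mistakes C xs = s L"
    unfolding optimal_mistakes_def s_def[symmetric]
    by (intro cInf_eq_minimum) (auto intro: order_trans)
  then show ?thesis
    by (auto simp: s_def)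
qed

text \<open>A class enters the game only through its labellings of \<open>xs\<close>, so a learner
  may work with any class that has the same ones.\<close>

lemma optimal_mistakes_cong:
  assumes "(\<lambda>c. map c xs) ` C = (\<lambda>c. map c xs) ` C'"
  shows "(SUP c\<in>C. informed_expected_mistakes L xs c) = (SUP c\<in>C'. informed_expected_mistakes L xs c)"
    and "optimal_mistakes C xs = optimal_mistakes C' xs"
proof -
  have "(\<lambda>c. informed_expected_mistakes L xs c) ` C = (\<lambda>c. informed_expected_mistakes L xs c) ` C'" for L
    using arg_cong[OF assms, of "image (expected_errors L)"]
    by (simp add: informed_expected_mistakes_eq image_image)
  then show "(SUP c\<in>C. informed_expected_mistakes L xs c) = (SUP c\<in>C'. informed_expected_mistakes L xs c)"
    and "optimal_mistakes C xs = optimal_mistakes C' xs"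
    by (simp_all add: optimal_mistakes_def)
qed


section \<open>Identifying the class\<close>

text \<open>The condition of \<open>valid_erm\<close> restricted to recorded answers, which is all
  that a learner can test.\<close>

definition admits :: "'a history \<Rightarrow> ('a \<Rightarrow> bool) set \<Rightarrow> bool" where
  "admits h C \<longleftrightarrow> (\<forall>S a. Query S a \<in> set h \<longrightarrow>
     (case a of
        Some c \<Rightarrow> c \<in> C \<and> consistent c S
      | None \<Rightarrow> \<not> (\<exists>c\<in>C. consistent c S)))"

lemma admits_SomeD:
  assumes "admits h C" "Query S (Some c) \<in> set h"
  shows "c \<in> C" "consistent c S"
  using assms unfolding admits_def by fastforce+

lemma admits_NoneD:
  assumes "admits h C" "Query S None \<in> set h" "c \<in> C"
  shows "\<not> consistent c S"
  using assms unfolding admits_def by fastforce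

text \<open>The choice depends on \<open>d\<close> and \<open>xs\<close> alone, so it is
  non-adaptive. \<open>d + 1\<close> points exceed the radius by one; with fewer distinct points
  \<open>zip\<close> truncates and samples repeat.\<close>

definition patterns :: "nat \<Rightarrow> 'a list \<Rightarrow> 'a sample list" where
  "patterns d xs = map (\<lambda>bs. fset_of_list (zip (take (Suc d) (remdups xs)) bs))
     (List.n_lists (Suc d) [False, True])"

lemma length_patterns: "length (patterns d xs) = 2 ^ (d + 1)"
  by (simp only: patterns_def length_map length_n_lists list.size numeral_2_eq_2
    One_nat_def add_0 add_Suc add_Suc_right add_0_right)

lemma consistent_pattern:
  assumes "ws = take (Suc d) (remdups xs)" "d < card (set xs)"
  shows "\<exists>S \<in> set (patterns d xs). \<forall>c. consistent c S \<longleftrightarrow> (\<forall>w\<in>set ws. c w = p w)"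
proof
  let ?S = "fset_of_list (zip ws (map p ws))"
  have "length ws = Suc d"
    using assms by (simp add: length_remdups_card_conv)
  then have "map p ws \<in> set (List.n_lists (Suc d) [False, True])"
    by (auto simp: set_n_lists simp del: List.n_lists.simps)
  then show "?S \<in> set (patterns d xs)"
    unfolding patterns_def assms(1) set_map by (rule imageI)
  show "\<forall>c. consistent c ?S \<longleftrightarrow> (\<forall>w\<in>set ws. c w = p w)"
    by (auto simp: consistent_def fset_of_list.rep_eq zip_map2 zip_same_conv_map)
qed

lemma in_hamming_ballI:
  assumes "{x. g x \<noteq> f x} \<subseteq> A" "finite A" "card A \<le> d"
  shows "g \<in> hamming_ball f d"
  using assms card_mono[of A "{x. g x \<noteq> f x}"] by (auto simp: hamming_ball_def intro: finite_subset)

text \<open>Two patterns decide: \<open>\<not> f\<close> compares the centres on the queried points,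
  and flipping \<open>f\<close> on all but one of these compares them elsewhere. Both depend on the
  unknown \<open>f\<close>, hence all labellings are asked.\<close>

lemma admits_center_unique:
  assumes f: "admits h (hamming_ball f d)" and f': "admits h (hamming_ball f' d)"
    and asked: "\<And>S. S \<in> set (patterns d xs) \<Longrightarrow> \<exists>a. Query S a \<in> set h"
    and card: "d < card (set xs)"
  shows "f = f'"
proof -
  define ws where "ws = take (Suc d) (remdups xs)"
  have W: "card (set ws) = Suc d"
    using card by (simp add: ws_def distinct_card length_remdups_card_conv)
  note pattern = consistent_pattern[OF ws_def card]
  have agree: "f w = f' w" if w: "w \<in> set ws" for w
  proof (rule ccontr)
    assume neq: "f w \<noteq> f' w"
    obtain S where S: "S \<in> set (patterns d xs)"
      "\<And>c. consistent c S \<longleftrightarrow> (\<forall>w\<in>set ws. c w = (\<not> f w))"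
      using pattern[of "\<lambda>w. \<not> f w"] by blast
    obtain a where a: "Query S a \<in> set h"
      using asked S(1) by blast
    \<comment> \<open>The labels \<open>\<not> f\<close> on \<open>ws\<close> force
      \<open>d + 1\<close> disagreements.\<close>
    have "c \<notin> hamming_ball f d" if "consistent c S" for c
    proof
      assume c: "c \<in> hamming_ball f d"
      have "set ws \<subseteq> {x. c x \<noteq> f x}"
        using that S(2) by auto
      then have "Suc d \<le> card {x. c x \<noteq> f x}"
        using c W card_mono[of "{x. c x \<noteq> f x}" "set ws"] by (auto simp: hamming_ball_def)
      then show False
        using c by (simp add: hamming_ball_def)
    qed
    then have "a = None"
      using admits_SomeD[OF f] a by (cases a) blast+
    \<comment> \<open>\<open>f'\<close> already has the label \<open>\<not> f w\<close> at
      \<open>w\<close>, so changes at the \<open>d\<close> other points suffice, against the answer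
      \<open>None\<close>.\<close>
    moreover define g where "g x = (if x \<in> set ws then \<not> f x else f' x)" for x
    have "g \<in> hamming_ball f' d"
      by (rule in_hamming_ballI[of _ _ "set ws - {w}"]) (use neq w W in \<open>auto simp: g_def\<close>)
    ultimately show False
      using admits_NoneD[OF f'] a S(2)[of g] by (auto simp: g_def)
  qed
  obtain w where w: "w \<in> set ws"
    using W by (cases ws) auto
  let ?p = "\<lambda>x. if x = w then f x else \<not> f x"
  obtain S where S: "S \<in> set (patterns d xs)"
    "\<And>c. consistent c S \<longleftrightarrow> (\<forall>x\<in>set ws. c x = ?p x)"
    using pattern[of ?p] by blast
  obtain a where a: "Query S a \<in> set h"
    using asked S(1) by blast
  \<comment> \<open>The \<open>d\<close> forced disagreements use up the radius, leaving none
    elsewhere. The centre \<open>k\<close> stands for both \<open>f\<close> and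
    \<open>f'\<close>.\<close>
  have saturated: "{x. c x \<noteq> k x} = set ws - {w}"
    if "c \<in> hamming_ball k d" "consistent c S" "\<And>x. x \<in> set ws \<Longrightarrow> k x = f x" for c k
    using that W w S(2)[of c]
    by (intro sym[OF card_seteq]) (auto simp: hamming_ball_def)
  let ?g = "\<lambda>x. if x \<in> set ws then ?p x else f x"
  have "?g \<in> hamming_ball f d"
    by (rule in_hamming_ballI[of _ _ "set ws - {w}"]) (use w W in auto)
  moreover have "consistent ?g S"
    using S(2) by auto
  ultimately obtain c where "a = Some c"
    using admits_NoneD[OF f] a by (cases a) auto
  then have "c \<in> hamming_ball f d" "c \<in> hamming_ball f' d" "consistent c S"
    using admits_SomeD[OF f] admits_SomeD[OF f'] a by auto
  \<comment> \<open>Labels are binary, so \<open>c\<close> and its disagreement set determine the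
    centre.\<close>
  then have "{x. c x \<noteq> f x} = {x. c x \<noteq> f' x}"
    using saturated[of c f] saturated[of c f'] agree by auto
  then show ?thesis
    by blast
qed

text \<open>Overwriting \<open>f\<close> on the at most \<open>d\<close> points of \<open>xs\<close>
  stays inside the ball.\<close>

lemma hamming_ball_shatters:
  assumes "card (set xs) \<le> d"
  shows "(\<lambda>c. map c xs) ` hamming_ball f d = (\<lambda>c. map c xs) ` UNIV"
proof -
  have "map c xs \<in> (\<lambda>c. map c xs) ` hamming_ball f d" for c
  proof
    show "map c xs = map (\<lambda>x. if x \<in> set xs then c x else f x) xs"
      by simp
    show "(\<lambda>x. if x \<in> set xs then c x else f x) \<in> hamming_ball f d"
      by (rule in_hamming_ballI[of _ _ "set xs"]) (use assms in auto)
  qed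
  then show ?thesis
    by auto
qed

text \<open>With at most \<open>d\<close> distinct points the answers may leave the centre open, but
  then every ball induces all labellings; hence the conclusion compares labellings, not
  classes.\<close>

lemma admits_labellings_unique:
  assumes "C \<in> hamming_family d" "C' \<in> hamming_family d" "admits h C" "admits h C'"
    and "\<And>S. S \<in> set (patterns d xs) \<Longrightarrow> \<exists>a. Query S a \<in> set h"
  shows "(\<lambda>c. map c xs) ` C = (\<lambda>c. map c xs) ` C'"
proof -
  obtain f f' where C: "C = hamming_ball f d" "C' = hamming_ball f' d"
    using assms(1,2) by (auto simp: hamming_family_def)
  show ?thesis
  proof (cases "card (set xs) \<le> d")
    case True
    then show ?thesis
      by (simp add: C hamming_ball_shatters)
  next
    case False
    then show ?thesis
      using admits_center_unique[of h f d f' xs] assms(3-5) by (simp add: C)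
  qed
qed


section \<open>Simulating an informed learner\<close>

definition queries :: "'a history \<Rightarrow> 'a history" where
  "queries h = filter (\<lambda>e. \<exists>S a. e = Query S a) h"

definition rounds :: "'a history \<Rightarrow> (bool \<times> bool) list" where
  "rounds h = concat (map (\<lambda>e. case e of Query S a \<Rightarrow> [] | Round b y \<Rightarrow> [(b, y)]) h)"

lemma num_mistakes_eq: "num_mistakes h = length (filter (\<lambda>(b, y). b \<noteq> y) (rounds h))"
  by (induction h) (auto simp: num_mistakes_def rounds_def split: event.splits)

lemma queries_append_Round: "queries (h @ [Round b y]) = queries h"
  by (simp add: queries_def)

lemma rounds_append_Round: "rounds (h @ [Round b y]) = rounds h @ [(b, y)]"
  by (simp add: rounds_def)

text \<open>Rounds leave \<open>queries\<close> unchanged, so the assumption on \<open>K\<close>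
  stays in force once \<open>q\<close> is recorded.\<close>

lemma play_simulates:
  assumes "\<And>h. queries h = q \<Longrightarrow> K h = Predict (L (rounds h))" "queries h = q"
  shows "map_pmf rounds (play orc K h ys) = informed_play L (rounds h) ys"
  using assms(2)
  by (induction ys arbitrary: h)
    (simp_all add: assms(1) map_bind_pmf queries_append_Round rounds_append_Round)

lemma queries_play:
  assumes "\<And>h. queries h = q \<Longrightarrow> K h = Predict (L (rounds h))" "queries h = q"
    and "h' \<in> set_pmf (play orc K h ys)"
  shows "queries h' = q"
  using assms(2,3)
proof (induction ys arbitrary: h)
  case (Cons y ys)
  then obtain b where "h' \<in> set_pmf (play orc K (h @ [Round b y]) ys)"
    by (auto simp: assms(1))
  then show ?case
    using Cons by (intro Cons.IH[of "h @ [Round b y]"]) (simp_all add: queries_append_Round)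
qed simp

primrec ask_all :: "'a sample list \<Rightarrow> ('a history \<Rightarrow> bool pmf) \<Rightarrow> 'a history \<Rightarrow> 'a computation" where
  "ask_all [] p h = Predict (p h)"
| "ask_all (S # Ss) p h = Ask S (\<lambda>a. ask_all Ss p (h @ [Query S a]))"

text \<open>The history behind each answer is existential: answers may depend on the past, and
  validity holds at every history.\<close>

lemma exec_ask_all:
  "\<exists>as. length as = length Ss \<and> (\<forall>(S, a) \<in> set (zip Ss as). \<exists>h. a = orc h S) \<and>
     exec orc (ask_all Ss p h) h =
       (p (h @ map2 Query Ss as), h @ map2 Query Ss as)"
proof (induction Ss arbitrary: h)
  case (Cons S Ss)
  obtain as where "length as = length Ss" "\<forall>(S, a) \<in> set (zip Ss as). \<exists>h. a = orc h S"
    "exec orc (ask_all Ss p (h @ [Query S (orc h S)])) (h @ [Query S (orc h S)]) =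
       (p (h @ [Query S (orc h S)] @ map2 Query Ss as), h @ [Query S (orc h S)] @ map2 Query Ss as)"
    using Cons[of "h @ [Query S (orc h S)]"] by auto
  then show ?case
    by (intro exI[of _ "orc h S # as"]) auto
qed simp

text \<open>\<open>SOME\<close> is evaluated anew before each prediction, but always on the same
  record of queries, so one class serves throughout.\<close>

definition simulator ::
  "nat \<Rightarrow> ('a list \<Rightarrow> ('a \<Rightarrow> bool) set \<Rightarrow> informed_learner) \<Rightarrow> 'a learner" where
  "simulator d opt xs h = ask_all (if h = [] then patterns d xs else [])
     (\<lambda>h. opt xs (SOME C. C \<in> hamming_family d \<and> admits (queries h) C) (rounds h)) h"

lemma simulator_correct:
  assumes C: "C \<in> hamming_family d" and valid: "valid_erm C orc" and opt: "\<And>xs C. C \<in> hamming_family d \<Longrightarrow>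
      (SUP c\<in>C. informed_expected_mistakes (opt xs C) xs c) = optimal_mistakes C xs"
  shows "h \<in> set_pmf (run (simulator d opt) orc xs c) \<Longrightarrow> num_queries h \<le> 2 ^ (d + 1)"
    and "(SUP c\<in>C. expected_mistakes (simulator d opt) orc xs c) = optimal_mistakes C xs"
proof -
  let ?K = "simulator d opt xs" and ?Ss = "patterns d xs"
  obtain as where as: "length as = length ?Ss" "\<forall>(S, a) \<in> set (zip ?Ss as). \<exists>h. a = orc h S"
    and exec: "exec orc (?K []) [] =
      (opt xs (SOME C. C \<in> hamming_family d \<and> admits (queries (map2 Query ?Ss as)) C)
        (rounds (map2 Query ?Ss as)), map2 Query ?Ss as)"
    using exec_ask_all[of ?Ss orc _ "[]"] unfolding simulator_def by fastforce
  define q where "q = map2 Query ?Ss as"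
  have q: "queries q = q" "rounds q = []" "length q = 2 ^ (d + 1)"
    using as(1) by (auto simp: q_def queries_def rounds_def length_patterns filter_id_conv split_beta)
  define C' where "C' = (SOME C. C \<in> hamming_family d \<and> admits q C)"
  have "admits q C"
    unfolding admits_def
  proof (intro allI impI)
    fix S a
    assume "Query S a \<in> set q"
    then obtain h where "a = orc h S"
      using as(2) by (auto simp: q_def)
    then show "case a of None \<Rightarrow> \<not> (\<exists>c\<in>C. consistent c S) | Some c \<Rightarrow> c \<in> C \<and> consistent c S"
      using valid unfolding valid_erm_def by metis
  qed
  \<comment> \<open>The true class is a candidate, so the choice succeeds; \<open>C'\<close> may
    still differ from \<open>C\<close>.\<close>
  moreover from this have C': "C' \<in> hamming_family d \<and> admits q C'"
    unfolding C'_def using C by (intro someI[of "\<lambda>C. C \<in> hamming_family d \<and> admits q C"]) blast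
  moreover have "\<exists>a. Query S a \<in> set q" if S: "S \<in> set ?Ss" for S
  proof -
    obtain i where "i < length ?Ss" "S = ?Ss ! i"
      using S by (auto simp: in_set_conv_nth)
    then have "q ! i = Query S (as ! i)" "i < length q"
      using as(1) by (auto simp: q_def)
    then show ?thesis
      by (metis nth_mem)
  qed
  ultimately have labellings: "(\<lambda>c. map c xs) ` C' = (\<lambda>c. map c xs) ` C"
    using C by (intro admits_labellings_unique) auto
  have K: "?K h = Predict (opt xs C' (rounds h))" if "queries h = q" for h
  proof -
    \<comment> \<open>There is at least one pattern, so no query is made after \<open>q\<close> is
      recorded.\<close>
    have "h \<noteq> []"
      using that q(3) by (auto simp: queries_def)
    then show ?thesis
      by (simp add: simulator_def that C'_def)
  qed
  \<comment> \<open>Without rounds nothing is asked and the history stays empty, hence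
    \<open>ys \<noteq> []\<close>.\<close>
  have play: "play orc ?K [] ys = play orc ?K q ys" if "ys \<noteq> []" for ys
    using that exec q by (cases ys) (simp_all add: K C'_def flip: q_def)
  have "num_queries h \<le> 2 ^ (d + 1)" if "h \<in> set_pmf (run (simulator d opt) orc xs c)" for c h
  proof (cases "xs = []")
    case True
    then show ?thesis
      using that by (simp add: run_def num_queries_def)
  next
    case False
    then have "queries h = q"
      using that queries_play[of q ?K "opt xs C'", OF K q(1)] by (simp add: run_def play)
    then show ?thesis
      using q(3) by (simp add: num_queries_def queries_def)
  qed
  then show "h \<in> set_pmf (run (simulator d opt) orc xs c) \<Longrightarrow> num_queries h \<le> 2 ^ (d + 1)" .
  have rounds_run: "map_pmf rounds (run (simulator d opt) orc xs c) = informed_play (opt xs C') [] (map c xs)" for c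
  proof (cases "xs = []")
    case True
    then show ?thesis
      by (simp add: run_def rounds_def)
  next
    case False
    then show ?thesis
      using play_simulates[of q ?K "opt xs C'", OF K q(1)] q(2) by (simp add: run_def play)
  qed
  have "expected_mistakes (simulator d opt) orc xs c = informed_expected_mistakes (opt xs C') xs c" for c
    unfolding expected_mistakes_def informed_expected_mistakes_def num_mistakes_eq
    by (simp flip: rounds_run)
  \<comment> \<open>\<open>opt xs C'\<close> is optimal for \<open>C'\<close>; equal labellings
    carry its worst case and the optimum over to \<open>C\<close>.\<close>
  then show "(SUP c\<in>C. expected_mistakes (simulator d opt) orc xs c) = optimal_mistakes C xs"
    using opt[of C' xs] C' optimal_mistakes_cong[OF labellings] by simp
qed

lemma center_in_hamming_ball: "f \<in> hamming_ball f d"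
  by (simp add: hamming_ball_def)

lemma hamming_family_nonempty: "C \<in> hamming_family d \<Longrightarrow> C \<noteq> {}"
  using center_in_hamming_ball by (auto simp: hamming_family_def)

theorem theoremH6:
  fixes d T :: nat
  shows "\<exists>A :: 'a learner.
    \<forall>C \<in> hamming_family d. \<forall>xs :: 'a list. length xs = T \<longrightarrow>
      (\<forall>orc. valid_erm C orc \<longrightarrow>
        (\<forall>c\<in>C. \<forall>h \<in> set_pmf (run A orc xs c). num_queries h \<le> 2 ^ (d + 1)) \<and>
        (SUP c\<in>C. expected_mistakes A orc xs c) = optimal_mistakes C xs)"
proof -
  have "\<forall>C. \<exists>L. C \<in> hamming_family d \<longrightarrow>
      (SUP c\<in>C. informed_expected_mistakes L xs c) = optimal_mistakes C xs" for xs :: "'a list"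
    using optimal_learner_exists hamming_family_nonempty by metis
  then obtain opt where "\<And>(xs :: 'a list) C. C \<in> hamming_family d \<Longrightarrow>
      (SUP c\<in>C. informed_expected_mistakes (opt xs C) xs c) = optimal_mistakes C xs"
    by metis
  note correct = simulator_correct[OF _ _ this]
  show ?thesis
    by (intro exI[of _ "simulator d opt"] ballI allI impI conjI) (auto dest: correct)
qed

end
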